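(* The constant $1/2$ in the asymptotic bound $|S\Delta A|/|A|\leqslant \tfrac12\sqrt{\varepsilon}+O(\varepsilon)$ for almost isoperimetric domains is sharp, in the following sense: for every $c<1/2$, every $C>0$ and every $\varepsilon_0>0$, there exist $\varepsilon\in(0,\varepsilon_0)$ and a domain $A\subset\mathbb{R}^2$ whose boundary is a rectifiable curve, with $|\partial A|^2\leqslant(16+\varepsilon)|A|$, such that every square $S$ with $|S|=|A|$ satisfies $$\frac{|S\Delta A|}{|A|}>c\sqrt{\varepsilon}+C\varepsilon .$$
   Context: The plane $\mathbb{R}^2$ is endowed with the $L^1$ metric $|(x_1,x_2)-(y_1,y_2)|=|x_1-y_1|+|x_2-y_2|$. A *domain* is the closure of the bounded connected component of the complement of a Jordan curve in $\mathbb{R}^2$; $\partial A$ denotes the boundary of $A$. For a measurable set $A$, $|A|$ is its Lebesgue measure; for a rectifiable curve $\gamma$, $|\gamma|$ is its length with respect to the $L^1$ metric; in particular $|\partial A|$ is the $L^1$ length of the Jordan curve $\partial A$. All squares (taken as full closed squares) have their sides parallel to the coordinate axes. $S\Delta A$ denotes the symmetric difference. *)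

theory Defs
  imports "HOL-Analysis.Analysis"
begin

type_synonym plane = "real \<times> real"

definition l1_dist :: "plane \<Rightarrow> plane \<Rightarrow> real" where
  "l1_dist x y = \<bar>fst x - fst y\<bar> + \<bar>snd x - snd y\<bar>"

text \<open>Lengths of the polygons inscribed in a path (parametrised, as in the library, by the
  unit interval), over all subdivisions of the unit interval.\<close>

definition l1_inscribed_lengths :: "(real \<Rightarrow> plane) \<Rightarrow> real set" where
  "l1_inscribed_lengths g =
     {(\<Sum>i<n. l1_dist (g (t i)) (g (t (Suc i)))) | (n::nat) (t::nat \<Rightarrow> real).
        t 0 = 0 \<and> t n = 1 \<and> (\<forall>i<n. t i \<le> t (Suc i))}"

definition l1_rectifiable :: "(real \<Rightarrow> plane) \<Rightarrow> bool" where
  "l1_rectifiable g \<longleftrightarrow> path g \<and> bdd_above (l1_inscribed_lengths g)"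

text \<open>Meaningful only for rectifiable paths: otherwise the supremum is an unspecified real.\<close>

definition l1_length :: "(real \<Rightarrow> plane) \<Rightarrow> real" where
  "l1_length g = Sup (l1_inscribed_lengths g)"

definition jordan_curve :: "(real \<Rightarrow> plane) \<Rightarrow> bool" where
  "jordan_curve g \<longleftrightarrow> simple_path g \<and> pathfinish g = pathstart g"

text \<open>By the Jordan curve theorem, \<^const>\<open>inside\<close> of a Jordan curve is the unique bounded
  component of its complement.\<close>

definition jordan_domain :: "plane set \<Rightarrow> bool" where
  "jordan_domain A \<longleftrightarrow> (\<exists>g. jordan_curve g \<and> A = closure (inside (path_image g)))"

definition axis_square :: "plane set \<Rightarrow> bool" where
  "axis_square S \<longleftrightarrow> (\<exists>a b s. s > 0 \<and> S = {a..a + s} \<times> {b..b + s})"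

end

theory Submission
  imports Defs
begin

text \<open>
  Rectangles close to a square are extremal. The rectangle with sides \<open>a\<close> and \<open>1 / a\<close>, where
  \<open>a > 1\<close>, has area 1 and perimeter \<open>2 * (a + 1 / a)\<close>, whose square is \<open>16 + 4 * (a - 1 / a)\<^sup>2\<close>.
  Hence it is almost isoperimetric with \<open>sqrt \<epsilon> = 2 * (a - 1 / a)\<close>, which is about \<open>4 * (a - 1)\<close>.
  A unit square, wherever it is placed, meets the rectangle in a set of width at most 1 and
  height at most \<open>1 / a\<close>, so the symmetric difference has area at least \<open>2 * (1 - 1 / a)\<close>, about
  \<open>2 * (a - 1)\<close> (lemma \<open>sym_diff_square_rect\<close>). The ratio of \<open>2 * (1 - 1 / a)\<close> to \<open>sqrt \<epsilon>\<close> is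
  \<open>1 / (a + 1)\<close>, which tends to \<open>1 / 2\<close> as \<open>a\<close> decreases to 1, while the term \<open>C * \<epsilon>\<close> is of second
  order in \<open>a - 1\<close>. So a suitable \<open>a\<close> exists for every \<open>c < 1 / 2\<close> (lemma \<open>ratio_exists\<close>).

  The boundary is traversed once at constant \<open>L\<^sup>1\<close> speed by \<open>rect_path\<close>. Both coordinates are
  differences of clamped linear functions of the arc length, and these nondecreasing clamps add
  up to the arc length itself. This makes the path 1-Lipschitz in arc length and so bounds every
  inscribed polygon by the perimeter at once, with no need to refine a subdivision at the corners.
  That the rectangle is a domain holds because the inside of the frontier of a bounded convex set
  is its interior.
\<close>

section \<open>The boundary of a rectangle as a rectifiable Jordan curve\<close>

definition ramp :: "real \<Rightarrow> real \<Rightarrow> real" where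
  "ramp l u = min (max u 0) l"

text \<open>Position after walking the distance \<open>u\<close> counterclockwise from the origin: one ramp for each
  of the four sides, in the order bottom, right, top, left.\<close>

definition rect_walk :: "real \<Rightarrow> real \<Rightarrow> real \<Rightarrow> plane" where
  "rect_walk a b u = (ramp a u - ramp a (u - (a + b)), ramp b (u - a) - ramp b (u - (2 * a + b)))"

definition rect_path :: "real \<Rightarrow> real \<Rightarrow> real \<Rightarrow> plane" where
  "rect_path a b t = rect_walk a b (2 * (a + b) * t)"

lemma sum_ramps:
  assumes "a > 0" "b > 0" "0 \<le> u" "u \<le> 2 * (a + b)"
  shows "ramp a u + ramp b (u - a) + ramp a (u - (a + b)) + ramp b (u - (2 * a + b)) = u"
  using assms unfolding ramp_def min_def max_def by auto

lemma ramp_mono: "u \<le> v \<Longrightarrow> ramp l u \<le> ramp l v"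
  unfolding ramp_def by auto

text \<open>Each coordinate changes by at most the sum of the increments of its two ramps, because these
  are monotone; by \<open>sum_ramps\<close> the four increments add up to \<open>v - u\<close>.\<close>

lemma l1_dist_rect_walk_le:
  assumes "a > 0" "b > 0" "0 \<le> u" "u \<le> v" "v \<le> 2 * (a + b)"
  shows "l1_dist (rect_walk a b u) (rect_walk a b v) \<le> v - u"
proof -
  have "ramp a u \<le> ramp a v" "ramp b (u - a) \<le> ramp b (v - a)"
    "ramp a (u - (a + b)) \<le> ramp a (v - (a + b))"
    "ramp b (u - (2 * a + b)) \<le> ramp b (v - (2 * a + b))"
    using assms by (auto intro!: ramp_mono)
  then show ?thesis
    using sum_ramps[of a b u] sum_ramps[of a b v] assms
    unfolding l1_dist_def rect_walk_def by auto
qed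

lemma rect_walk_sides:
  assumes "a > 0" "b > 0"
  shows "0 \<le> u \<Longrightarrow> u \<le> a \<Longrightarrow> rect_walk a b u = (u, 0)"
    and "a \<le> u \<Longrightarrow> u \<le> a + b \<Longrightarrow> rect_walk a b u = (a, u - a)"
    and "a + b \<le> u \<Longrightarrow> u \<le> 2 * a + b \<Longrightarrow> rect_walk a b u = (2 * a + b - u, b)"
    and "2 * a + b \<le> u \<Longrightarrow> u \<le> 2 * (a + b) \<Longrightarrow> rect_walk a b u = (0, 2 * (a + b) - u)"
  using assms unfolding rect_walk_def ramp_def by auto

lemma rect_walk_cases:
  assumes "a > 0" "b > 0" "0 \<le> u" "u \<le> 2 * (a + b)"
  shows "u \<le> a \<and> rect_walk a b u = (u, 0)
    \<or> a \<le> u \<and> u \<le> a + b \<and> rect_walk a b u = (a, u - a)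
    \<or> a + b \<le> u \<and> u \<le> 2 * a + b \<and> rect_walk a b u = (2 * a + b - u, b)
    \<or> 2 * a + b \<le> u \<and> rect_walk a b u = (0, 2 * (a + b) - u)"
  using assms rect_walk_sides[of a b u] by linarith

lemma rect_walk_inj:
  assumes ab: "a > 0" "b > 0"
    and u: "0 \<le> u" "u \<le> 2 * (a + b)" and v: "0 \<le> v" "v \<le> 2 * (a + b)"
    and eq: "rect_walk a b u = rect_walk a b v"
  shows "u = v \<or> u = 0 \<and> v = 2 * (a + b) \<or> u = 2 * (a + b) \<and> v = 0"
  using rect_walk_cases[OF ab u] rect_walk_cases[OF ab v] eq ab u v
  by (elim disjE conjE) auto

lemma frontier_rect:
  fixes a b :: real
  assumes "a > 0" "b > 0"
  shows "frontier ({0..a} \<times> {0..b}) = {0..a} \<times> {0..b} - {0<..<a} \<times> {0<..<b}"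
  by (simp add: frontier_def closure_Times interior_Times)

lemma rect_walk_image:
  assumes ab: "a > 0" "b > 0"
  shows "rect_walk a b ` {0..2 * (a + b)} = frontier ({0..a} \<times> {0..b})"
proof (intro subset_antisym subsetI)
  fix p assume "p \<in> rect_walk a b ` {0..2 * (a + b)}"
  then obtain u where u: "0 \<le> u" "u \<le> 2 * (a + b)" "p = rect_walk a b u" by auto
  show "p \<in> frontier ({0..a} \<times> {0..b})"
    unfolding frontier_rect[OF ab] using rect_walk_cases[OF ab u(1,2)] u ab by auto
next
  fix p assume "p \<in> frontier ({0..a} \<times> {0..b})"
  then obtain x y where p: "p = (x, y)" and xy: "0 \<le> x" "x \<le> a" "0 \<le> y" "y \<le> b"
    and side: "y = 0 \<or> x = a \<or> y = b \<or> x = 0"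
    unfolding frontier_rect[OF ab] by (cases p) force
  note sides = rect_walk_sides[OF ab]
  from side show "p \<in> rect_walk a b ` {0..2 * (a + b)}"
  proof (elim disjE)
    assume "y = 0"
    then show ?thesis using xy ab sides(1)[of x] p by (intro image_eqI[of _ _ x]) auto
  next
    assume "x = a"
    then show ?thesis using xy ab sides(2)[of "a + y"] p by (intro image_eqI[of _ _ "a + y"]) auto
  next
    assume "y = b"
    then show ?thesis using xy ab sides(3)[of "2 * a + b - x"] p
      by (intro image_eqI[of _ _ "2 * a + b - x"]) auto
  next
    assume "x = 0"
    then show ?thesis using xy ab sides(4)[of "2 * (a + b) - y"] p
      by (intro image_eqI[of _ _ "2 * (a + b) - y"]) auto
  qed
qed

lemma path_image_rect_path:
  assumes ab: "a > 0" "b > 0"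
  shows "path_image (rect_path a b) = frontier ({0..a} \<times> {0..b})"
proof -
  have "path_image (rect_path a b) = rect_walk a b ` ((\<lambda>t. 2 * (a + b) * t) ` {0..1})"
    unfolding path_image_def rect_path_def by (simp add: image_image)
  also have "(\<lambda>t. 2 * (a + b) * t) ` {0..1} = {0..2 * (a + b)}"
    using ab by (simp add: image_mult_atLeastAtMost)
  finally show ?thesis using rect_walk_image[OF ab] by simp
qed

lemma path_rect_path: "path (rect_path a b)"
  unfolding path_def rect_path_def rect_walk_def ramp_def by (intro continuous_intros)

lemma scaled_param:
  fixes a b t :: real
  assumes "a > 0" "b > 0" "0 \<le> t" "t \<le> 1"
  shows "0 \<le> 2 * (a + b) * t" "2 * (a + b) * t \<le> 2 * (a + b)"
  using assms mult_left_le[of t "2 * (a + b)"] by auto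

lemma jordan_curve_rect_path:
  assumes ab: "a > 0" "b > 0"
  shows "jordan_curve (rect_path a b)"
proof -
  have "loop_free (rect_path a b)"
    unfolding loop_free_def
  proof (intro ballI impI)
    fix s t :: real
    assume st: "s \<in> {0..1}" "t \<in> {0..1}" and eq: "rect_path a b s = rect_path a b t"
    have "2 * (a + b) * s = 2 * (a + b) * t
      \<or> 2 * (a + b) * s = 0 \<and> 2 * (a + b) * t = 2 * (a + b)
      \<or> 2 * (a + b) * s = 2 * (a + b) \<and> 2 * (a + b) * t = 0"
      using st ab eq unfolding rect_path_def
      by (intro rect_walk_inj scaled_param) auto
    then show "s = t \<or> s = 0 \<and> t = 1 \<or> s = 1 \<and> t = 0" using ab by auto
  qed
  moreover have "rect_path a b 1 = rect_path a b 0"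
    using rect_walk_sides(1)[OF ab, of 0] rect_walk_sides(4)[OF ab, of "2 * (a + b)"] ab
    by (simp add: rect_path_def)
  ultimately show ?thesis
    unfolding jordan_curve_def simple_path_def pathfinish_def pathstart_def
    by (simp add: path_rect_path)
qed

text \<open>Since the walk is 1-Lipschitz in arc length, the sides of an inscribed polygon are dominated
  by the terms of a telescoping sum.\<close>

lemma rect_path_inscribed_le:
  assumes ab: "a > 0" "b > 0" and L: "L \<in> l1_inscribed_lengths (rect_path a b)"
  shows "L \<le> 2 * (a + b)"
proof -
  obtain n t where L: "L = (\<Sum>i<n. l1_dist (rect_path a b (t i)) (rect_path a b (t (Suc i))))"
    and t: "t 0 = 0" "t n = 1" "\<forall>i<n. t i \<le> t (Suc i)"
    using L unfolding l1_inscribed_lengths_def by auto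
  have mono: "t i \<le> t j" if "i \<le> j" "j \<le> n" for i j
    using that
  proof (induction rule: dec_induct)
    case (step k)
    then have "t i \<le> t k" "t k \<le> t (Suc k)" using t(3) by auto
    then show ?case by (rule order_trans)
  qed simp
  have "L \<le> (\<Sum>i<n. 2 * (a + b) * t (Suc i) - 2 * (a + b) * t i)"
    unfolding L rect_path_def
  proof (intro sum_mono l1_dist_rect_walk_le ab)
    fix i assume "i \<in> {..<n}"
    then show "0 \<le> 2 * (a + b) * t i" "2 * (a + b) * t (Suc i) \<le> 2 * (a + b)"
      "2 * (a + b) * t i \<le> 2 * (a + b) * t (Suc i)"
      using mono[of 0 i] mono[of "Suc i" n] mono[of 0 "Suc i"] t ab
      by (auto intro!: scaled_param)
  qed
  also have "\<dots> = 2 * (a + b)"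
    using sum_lessThan_telescope[of "\<lambda>i. 2 * (a + b) * t i" n] t by simp
  finally show ?thesis .
qed

lemma l1_rectifiable_rect_path:
  assumes "a > 0" "b > 0"
  shows "l1_rectifiable (rect_path a b)"
  unfolding l1_rectifiable_def
  using path_rect_path rect_path_inscribed_le[OF assms] unfolding bdd_above_def by blast

lemma l1_length_rect_path:
  assumes ab: "a > 0" "b > 0"
  shows "0 \<le> l1_length (rect_path a b)" "l1_length (rect_path a b) \<le> 2 * (a + b)"
proof -
  let ?X = "l1_inscribed_lengths (rect_path a b)"
  have mem: "l1_dist (rect_path a b 0) (rect_path a b 1) \<in> ?X"
    unfolding l1_inscribed_lengths_def
    by (intro CollectI exI[of _ 1] exI[of _ real]) auto
  then show "l1_length (rect_path a b) \<le> 2 * (a + b)"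
    unfolding l1_length_def using rect_path_inscribed_le[OF ab] by (intro cSup_least) auto
  have "0 \<le> l1_dist (rect_path a b 0) (rect_path a b 1)" by (simp add: l1_dist_def)
  also have "\<dots> \<le> l1_length (rect_path a b)"
    using mem l1_rectifiable_rect_path[OF ab] unfolding l1_length_def l1_rectifiable_def
    by (intro cSup_upper) auto
  finally show "0 \<le> l1_length (rect_path a b)" .
qed

lemma jordan_domain_rect:
  fixes a b :: real
  assumes ab: "a > 0" "b > 0"
  shows "jordan_domain ({0..a} \<times> {0..b})"
proof -
  let ?A = "{0..a} \<times> {0..b}"
  have "inside (frontier ?A) = interior ?A"
    by (intro inside_frontier_eq_interior convex_Times bounded_Times) auto
  moreover have "closure (interior ?A) = ?A"
    using ab by (simp add: interior_Times closure_Times)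
  ultimately show ?thesis
    unfolding jordan_domain_def
    using jordan_curve_rect_path[OF ab] path_image_rect_path[OF ab] by force
qed

section \<open>Measures of rectangles and symmetric differences\<close>

lemma
  fixes p q r s :: real
  shows fmeasurable_rect: "{p..q} \<times> {r..s} \<in> lmeasurable"
    and measure_rect: "p \<le> q \<Longrightarrow> r \<le> s \<Longrightarrow> measure lebesgue ({p..q} \<times> {r..s}) = (q - p) * (s - r)"
proof -
  have eq: "{p..q} \<times> {r..s} = cbox (p, r) (q, s)" by (simp add: cbox_Pair_eq)
  show "{p..q} \<times> {r..s} \<in> lmeasurable" unfolding eq by simp
  assume "p \<le> q" "r \<le> s"
  then show "measure lebesgue ({p..q} \<times> {r..s}) = (q - p) * (s - r)"
    unfolding eq by (simp add: content_Pair)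
qed

lemma measure_sym_diff_Int:
  assumes "S \<in> fmeasurable M" "A \<in> fmeasurable M"
  shows "measure M (sym_diff S A) = measure M S + measure M A - 2 * measure M (S \<inter> A)"
proof -
  have "S - A = S - S \<inter> A" "A - S = A - S \<inter> A" by auto
  then have "measure M (S - A) = measure M S - measure M (S \<inter> A)"
    "measure M (A - S) = measure M A - measure M (S \<inter> A)"
    using assms by (simp_all add: measurable_measure_Diff fmeasurable.Int fmeasurableD)
  moreover have "(S - A) \<inter> (A - S) = {}" by auto
  then have "measure M (sym_diff S A) = measure M (S - A) + measure M (A - S)"
    using measure_Un3[of "S - A" M "A - S"] assms by (simp add: fmeasurable_Diff fmeasurableD)
  ultimately show ?thesis by simp
qed

text \<open>A square of area 1 has side 1, so its intersection with the rectangle lies in a box of width 1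
  (that of the square) and height \<open>1 / a\<close> (that of the rectangle).\<close>

lemma sym_diff_square_rect:
  fixes a :: real
  assumes a: "a > 0" and S: "axis_square S" "measure lebesgue S = 1"
  shows "measure lebesgue (sym_diff S ({0..a} \<times> {0..1 / a})) \<ge> 2 * (1 - 1 / a)"
proof -
  let ?A = "{0..a} \<times> {0..1 / a}"
  obtain x y s where s: "s > 0" and S_eq: "S = {x..x + s} \<times> {y..y + s}"
    using S(1) unfolding axis_square_def by blast
  have "s * s = 1" using S(2) s by (simp add: S_eq measure_rect)
  then have "s = 1" using s by (metis abs_of_pos abs_square_eq_1 power2_eq_square)
  have "measure lebesgue (S \<inter> ?A) \<le> measure lebesgue ({x..x + 1} \<times> {0..1 / a})"
    by (intro measure_mono_fmeasurable)
      (auto simp: S_eq \<open>s = 1\<close> fmeasurable_rect intro!: fmeasurableD fmeasurable.Int)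
  also have "\<dots> = 1 / a" using a by (simp add: measure_rect)
  finally have "measure lebesgue (S \<inter> ?A) \<le> 1 / a" .
  moreover have "measure lebesgue ?A = 1" using a by (simp add: measure_rect)
  ultimately show ?thesis
    using measure_sym_diff_Int[of S lebesgue ?A] S(2) by (simp add: S_eq fmeasurable_rect)
qed

section \<open>Sharpness of the constant\<close>

text \<open>All terms are divisible by \<open>1 - 1 / a\<close>, since \<open>a - 1 / a = (1 - 1 / a) * (a + 1)\<close>. After division
  the left-hand side of the last inequality tends to \<open>4 * c < 2\<close> as \<open>a\<close> decreases to 1.\<close>

lemma ratio_exists:
  fixes c C \<epsilon>\<^sub>0 :: real
  assumes c: "c < 1 / 2" and e: "\<epsilon>\<^sub>0 > 0"
  obtains a where "a > 1" "4 * (a - 1 / a)\<^sup>2 < \<epsilon>\<^sub>0"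
    "c * (2 * (a - 1 / a)) + C * (4 * (a - 1 / a)\<^sup>2) < 2 * (1 - 1 / a)"
proof -
  let ?f = "\<lambda>a. 2 * c * (a + 1) + 4 * C * (1 - 1 / a) * (a + 1)\<^sup>2"
  have "(?f \<longlongrightarrow> 4 * c) (at_right 1)"
    by (auto intro!: tendsto_eq_intros)
  then have "eventually (\<lambda>a. ?f a < 2) (at_right 1)"
    using c by (intro order_tendstoD) auto
  moreover have "((\<lambda>a::real. 4 * (a - 1 / a)\<^sup>2) \<longlongrightarrow> 0) (at_right 1)"
    by (auto intro!: tendsto_eq_intros)
  then have "eventually (\<lambda>a. 4 * (a - 1 / a)\<^sup>2 < \<epsilon>\<^sub>0) (at_right 1)"
    using e by (intro order_tendstoD) auto
  moreover have "eventually (\<lambda>a. (1::real) < a) (at_right 1)"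
    by (simp add: eventually_at_right_less)
  ultimately have "eventually (\<lambda>a. ?f a < 2 \<and> 4 * (a - 1 / a)\<^sup>2 < \<epsilon>\<^sub>0 \<and> 1 < a) (at_right 1)"
    by eventually_elim auto
  then obtain a where a: "?f a < 2" "4 * (a - 1 / a)\<^sup>2 < \<epsilon>\<^sub>0" "1 < a"
    using eventually_happens' trivial_limit_at_right_real by blast
  have expand: "c * (2 * (r * (a + 1))) + C * (4 * (r * (a + 1))\<^sup>2)
      = r * (2 * c * (a + 1) + 4 * C * r * (a + 1)\<^sup>2)" for r
    by (simp add: algebra_simps power2_eq_square)
  have fac: "a - 1 / a = (1 - 1 / a) * (a + 1)" using a by (simp add: field_simps)
  have "c * (2 * (a - 1 / a)) + C * (4 * (a - 1 / a)\<^sup>2) = (1 - 1 / a) * ?f a"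
    unfolding fac by (rule expand)
  also have "\<dots> < (1 - 1 / a) * 2"
    using a by (intro mult_strict_left_mono) auto
  finally show thesis using a by (intro that[of a]) auto
qed

theorem mainTheorem4:
  fixes c C \<epsilon>\<^sub>0 :: real
  assumes "c < 1 / 2" and "C > 0" and "\<epsilon>\<^sub>0 > 0"
  shows "\<exists>(\<epsilon>::real) (A::plane set) (g::real \<Rightarrow> plane).
           0 < \<epsilon> \<and> \<epsilon> < \<epsilon>\<^sub>0 \<and>
           jordan_domain A \<and>
           jordan_curve g \<and> path_image g = frontier A \<and> l1_rectifiable g \<and>
           (l1_length g)\<^sup>2 \<le> (16 + \<epsilon>) * measure lebesgue A \<and>
           (\<forall>S. axis_square S \<and> measure lebesgue S = measure lebesgue A \<longrightarrow>
                measure lebesgue (sym_diff S A) / measure lebesgue A > c * sqrt \<epsilon> + C * \<epsilon>)"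
proof -
  obtain a where a: "a > 1" and small: "4 * (a - 1 / a)\<^sup>2 < \<epsilon>\<^sub>0"
    and gap: "c * (2 * (a - 1 / a)) + C * (4 * (a - 1 / a)\<^sup>2) < 2 * (1 - 1 / a)"
    using ratio_exists assms(1,3) by metis
  define \<epsilon> where "\<epsilon> = 4 * (a - 1 / a)\<^sup>2"
  let ?A = "{0..a} \<times> {0..1 / a}" and ?g = "rect_path a (1 / a)"
  have pos: "a > 0" "1 / a > 0" using a by auto
  have "1 / a < a" using a by (simp add: divide_less_eq) (smt (verit) mult_less_cancel_left1)
  then have "0 < \<epsilon>" and sqrt: "sqrt \<epsilon> = 2 * (a - 1 / a)"
    unfolding \<epsilon>_def by (simp_all add: real_sqrt_mult)
  have area: "measure lebesgue ?A = 1" using pos by (simp add: measure_rect)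
  have "(l1_length ?g)\<^sup>2 \<le> (2 * (a + 1 / a))\<^sup>2"
    using l1_length_rect_path[OF pos] by (intro power_mono)
  also have "\<dots> = 16 + \<epsilon>"
    unfolding \<epsilon>_def using a by (simp add: field_simps power2_eq_square)
  finally have len: "(l1_length ?g)\<^sup>2 \<le> (16 + \<epsilon>) * measure lebesgue ?A" using area by simp
  have "measure lebesgue (sym_diff S ?A) / measure lebesgue ?A > c * sqrt \<epsilon> + C * \<epsilon>"
    if "axis_square S \<and> measure lebesgue S = measure lebesgue ?A" for S
    using sym_diff_square_rect[of a S] gap that area pos unfolding sqrt \<epsilon>_def[symmetric] by simp
  then show ?thesis
    using \<open>0 < \<epsilon>\<close> small len jordan_domain_rect[OF pos] jordan_curve_rect_path[OF pos]
      path_image_rect_path[OF pos] l1_rectifiable_rect_path[OF pos]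
    unfolding \<epsilon>_def[symmetric] by blast
qed

end
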